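(* $\mathfrak{L}(SL(2,\mathbb{Z})) \subsetneq \mathfrak{L}(SL(3,\mathbb{Z}))$.
   Context: For a group $G$ with identity $e$, a $G$-automaton is a tuple $(Q,\Sigma,G,\delta,q_0,Q_a)$ where $Q$ is a finite set of states, $\Sigma$ a finite input alphabet, $q_0\in Q$ the initial state, $Q_a\subseteq Q$ the accepting states, and $\delta$ assigns to each $(q,\sigma)\in Q\times(\Sigma\cup\{\varepsilon\})$ a finite set of pairs $(q',m)\in Q\times G$. The register holds an element of $G$, initially $e$; using a transition $(q',m)\in\delta(q,\sigma)$ the automaton reads $\sigma$ (or nothing if $\sigma=\varepsilon$), moves to $q'$ and replaces the register content $x$ by $xm$. A word is accepted if some computation reads it entirely and ends in an accepting state with register equal to $e$. $\mathfrak{L}(G)$ is the class of languages recognized by $G$-automata. $SL(n,\mathbb{Z})$ is the group of $n\times n$ integer matrices of determinant $1$. *)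

theory Defs
  imports "HOL-Analysis.Analysis"
begin

text \<open>A group G is given by its multiplication, identity and carrier.
  The special linear group SL(n,Z) is rendered on integer matrices int^'n^'n
  with carrier {A. det A = 1}, product (**), identity mat 1.\<close>

definition SL_carrier :: "(int^'n^'n) set" where
  "SL_carrier = {A. det A = 1}"

text \<open>A G-automaton with states in nat and input letters in nat.
  Transitions: a finite set of tuples (q, s, q', m), where s = None means an
  epsilon move and s = Some a means reading the letter a; m is the group element
  by which the register is right-multiplied.\<close>

definition G_automaton ::
  "'g set \<Rightarrow> nat set \<Rightarrow> nat set \<Rightarrow> (nat \<times> nat option \<times> nat \<times> 'g) set \<Rightarrow> nat \<Rightarrow> nat set \<Rightarrow> bool"
  where
  "G_automaton Gc Q \<Sigma> \<delta> q0 Qa \<longleftrightarrow>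
     finite Q \<and> finite \<Sigma> \<and> q0 \<in> Q \<and> Qa \<subseteq> Q \<and> finite \<delta> \<and>
     (\<forall>(q, s, q', m) \<in> \<delta>. q \<in> Q \<and> q' \<in> Q \<and> m \<in> Gc \<and>
        (case s of None \<Rightarrow> True | Some a \<Rightarrow> a \<in> \<Sigma>))"

text \<open>reach gmul e delta q0 q w x: starting in q0 with register e, some computation
  reads exactly w and ends in state q with register x.\<close>
inductive reach ::
  "('g \<Rightarrow> 'g \<Rightarrow> 'g) \<Rightarrow> 'g \<Rightarrow> (nat \<times> nat option \<times> nat \<times> 'g) set \<Rightarrow> nat \<Rightarrow> nat \<Rightarrow> nat list \<Rightarrow> 'g \<Rightarrow> bool"
  for gmul e \<delta> q0 where
  start: "reach gmul e \<delta> q0 q0 [] e"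
| read: "reach gmul e \<delta> q0 q w x \<Longrightarrow> (q, Some a, q', m) \<in> \<delta> \<Longrightarrow>
           reach gmul e \<delta> q0 q' (w @ [a]) (gmul x m)"
| eps: "reach gmul e \<delta> q0 q w x \<Longrightarrow> (q, None, q', m) \<in> \<delta> \<Longrightarrow>
           reach gmul e \<delta> q0 q' w (gmul x m)"

definition accepted_lang ::
  "('g \<Rightarrow> 'g \<Rightarrow> 'g) \<Rightarrow> 'g \<Rightarrow> (nat \<times> nat option \<times> nat \<times> 'g) set \<Rightarrow> nat \<Rightarrow> nat set \<Rightarrow> nat list set"
  where
  "accepted_lang gmul e \<delta> q0 Qa = {w. \<exists>q\<in>Qa. reach gmul e \<delta> q0 q w e}"

text \<open>The class \<L>(G) of languages (over finite alphabets of natural-number letters)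
  recognised by G-automata.\<close>
definition lang_class ::
  "'g set \<Rightarrow> ('g \<Rightarrow> 'g \<Rightarrow> 'g) \<Rightarrow> 'g \<Rightarrow> nat list set set" where
  "lang_class Gc gmul e =
     {L. \<exists>Q \<Sigma> \<delta> q0 Qa. G_automaton Gc Q \<Sigma> \<delta> q0 Qa \<and> L = accepted_lang gmul e \<delta> q0 Qa}"

abbreviation lang_SL :: "('n::finite) itself \<Rightarrow> nat list set set" where
  "lang_SL (_ :: 'n itself) \<equiv> lang_class (SL_carrier :: (int^'n^'n) set) (**) (mat 1)"

end

theory Submission
  imports Defs "HOL-Library.Sublist"
begin

text \<open>
  SL(2,Z) embeds into SL(3,Z) as the upper left block, so every SL(2,Z)-language is an
  SL(3,Z)-language, while the commuting shears [[1,u,v],[0,1,0],[0,0,1]] let an SL(3,Z)-automaton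
  keep two independent counters and recognise {0^n 1^n 2^n}.

  That language is not an SL(2,Z)-language. The matrices [[1,+-2],[0,1]] and [[1,0],[+-2,1]]
  generate a free group (ping-pong) containing all matrices congruent to the identity modulo 4, a
  subgroup of finite index. Keeping a coset representative in the state, an SL(2,Z)-automaton is
  simulated by one whose register is a freely reduced word, changed by one push or pop per step.
  In an accepting run, two segments with equal end labels, nested so that the stack is the same at
  their outer ends and at their inner ends, can be repeated together; for {0^n 1^n 2^n} this forces
  them to read nothing. Choosing shortest such segments and counting returns to a stack level then
  bounds the length of every accepted word.
\<close>

section \<open>Two-by-two matrices and the Sanov generators\<close>

definition mat2 :: "'a \<Rightarrow> 'a \<Rightarrow> 'a \<Rightarrow> 'a \<Rightarrow> 'a^2^2" where
  "mat2 a b c d = (\<chi> i j. if i = 1 then (if j = 1 then a else b) else (if j = 1 then c else d))"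

lemma mat2_nth [simp]:
  "mat2 a b c d $ 1 $ 1 = a" "mat2 a b c d $ 1 $ 2 = b"
  "mat2 a b c d $ 2 $ 1 = c" "mat2 a b c d $ 2 $ 2 = d"
  by (simp_all add: mat2_def)

lemma mat2_eta: "M = mat2 (M$1$1) (M$1$2) (M$2$1) (M$2$2)"
  unfolding vec_eq_iff forall_2 by simp

lemma mat2_cases:
  obtains a b c d where "M = mat2 a b c d"
  using mat2_eta by blast

lemma mat2_eq_iff [simp]:
  "mat2 a b c d = mat2 a' b' c' d' \<longleftrightarrow> a = a' \<and> b = b' \<and> c = c' \<and> d = d'"
  unfolding vec_eq_iff forall_2 by simp

lemma mat2_mult [simp]:
  fixes a b c d :: "'a::semiring_1"
  shows "mat2 a b c d ** mat2 a' b' c' d' =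
    mat2 (a*a' + b*c') (a*b' + b*d') (c*a' + d*c') (c*b' + d*d')"
  unfolding vec_eq_iff forall_2 by (simp add: matrix_matrix_mult_def sum_2)

lemma mat2_mult_vec_nth [simp]:
  fixes a b c d :: "'a::semiring_1"
  shows "(mat2 a b c d *v v) $ 1 = a * v$1 + b * v$2"
    and "(mat2 a b c d *v v) $ 2 = c * v$1 + d * v$2"
  by (simp_all add: matrix_vector_mult_def sum_2)

lemma mat2_one: "(mat 1 :: 'a::zero_neq_one^2^2) = mat2 1 0 0 1"
  unfolding vec_eq_iff forall_2 by (simp add: mat_def)

lemma det_mat2 [simp]: "det (mat2 a b c d) = a*d - b*c"
  by (simp add: det_2)

definition adj2 :: "'a::ab_group_add^2^2 \<Rightarrow> 'a^2^2" where
  "adj2 M = mat2 (M$2$2) (- M$1$2) (- M$2$1) (M$1$1)"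

lemma mult_adj2:
  fixes M :: "'a::comm_ring_1^2^2"
  assumes "det M = 1"
  shows "M ** adj2 M = mat 1"
  using assms by (cases M rule: mat2_cases) (simp add: adj2_def mat2_one algebra_simps)

lemma adj2_mult:
  fixes M :: "'a::comm_ring_1^2^2"
  assumes "det M = 1"
  shows "adj2 M ** M = mat 1"
  using assms by (cases M rule: mat2_cases) (simp add: adj2_def mat2_one algebra_simps)

lemma det_adj2 [simp]: "det (adj2 M) = det (M :: 'a::comm_ring_1^2^2)"
  by (cases M rule: mat2_cases) (simp add: adj2_def algebra_simps)

type_synonym gen = "bool \<times> bool"

definition gen_mat :: "gen \<Rightarrow> int^2^2" where
  "gen_mat g = (let s = if snd g then -2 else 2 in if fst g then mat2 1 0 s 1 else mat2 1 s 0 1)"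

definition gen_inv :: "gen \<Rightarrow> gen" where
  "gen_inv g = (fst g, \<not> snd g)"

lemma gen_inv_gen_inv [simp]: "gen_inv (gen_inv g) = g"
  by (simp add: gen_inv_def)

lemma gen_mat_mult_gen_inv [simp]: "gen_mat g ** gen_mat (gen_inv g) = mat 1"
  by (simp add: gen_mat_def gen_inv_def mat2_one Let_def)

lemma gen_mat_gen_inv_mult [simp]: "gen_mat (gen_inv g) ** gen_mat g = mat 1"
  using gen_mat_mult_gen_inv[of "gen_inv g"] by simp

lemma gen_mat_cancel [simp]:
  "gen_mat g ** (gen_mat (gen_inv g) ** M) = M"
  "gen_mat (gen_inv g) ** (gen_mat g ** M) = M"
  by (metis matrix_mul_assoc matrix_mul_lid gen_mat_mult_gen_inv gen_mat_gen_inv_mult)+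

lemma det_gen_mat [simp]: "det (gen_mat g) = 1"
  by (simp add: gen_mat_def Let_def)

definition pingpong_target :: "gen \<Rightarrow> (int^2) set" where
  "pingpong_target g = {v. (if fst g then \<bar>v$1\<bar> < \<bar>v$2\<bar> else \<bar>v$2\<bar> < \<bar>v$1\<bar>) \<and>
                      (if snd g then v$1 * v$2 < 0 else 0 < v$1 * v$2)}"

definition pingpong_source :: "gen \<Rightarrow> (int^2) set" where
  "pingpong_source g = {v. if fst g then \<bar>v$2\<bar> < \<bar>v$1\<bar> else \<bar>v$1\<bar> < \<bar>v$2\<bar>} \<union> pingpong_target g"

lemma gen_mat_pingpong: "v \<in> pingpong_source g \<Longrightarrow> gen_mat g *v v \<in> pingpong_target g"
  by (cases g) (auto simp: pingpong_source_def pingpong_target_def gen_mat_def zero_less_mult_iff mult_less_0_iff)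

lemma pingpong_target_subset_source: "h \<noteq> gen_inv g \<Longrightarrow> pingpong_target h \<subseteq> pingpong_source g"
  by (cases g; cases h) (auto simp: pingpong_source_def pingpong_target_def gen_inv_def)

fun word_mat :: "gen list \<Rightarrow> int^2^2" where
  "word_mat [] = mat 1"
| "word_mat (g # gs) = gen_mat g ** word_mat gs"

lemma word_mat_append [simp]: "word_mat (xs @ ys) = word_mat xs ** word_mat ys"
  by (induction xs) (auto simp: matrix_mul_assoc)

lemma word_mat_inverse: "word_mat (rev (map gen_inv ws)) ** word_mat ws = mat 1"
  by (induction ws) (simp_all flip: matrix_mul_assoc)

lemma word_mat_cancel_left: "word_mat u ** A = word_mat u ** B \<Longrightarrow> A = B"
  by (metis matrix_mul_assoc matrix_mul_lid word_mat_inverse)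

definition reduced :: "gen list \<Rightarrow> bool" where
  "reduced = successively (\<lambda>g h. h \<noteq> gen_inv g)"

lemma reduced_word_mat_pingpong:
  "reduced ws \<Longrightarrow> ws \<noteq> [] \<Longrightarrow> v \<in> pingpong_source (last ws) \<Longrightarrow> word_mat ws *v v \<in> pingpong_target (hd ws)"
proof (induction ws rule: induct_list012)
  case (2 g)
  then show ?case using gen_mat_pingpong by simp
next
  case (3 g h ws)
  then have "word_mat (h # ws) *v v \<in> pingpong_target h" "h \<noteq> gen_inv g"
    by (simp_all add: reduced_def)
  then have "word_mat (h # ws) *v v \<in> pingpong_source g"
    using pingpong_target_subset_source by blast
  then show ?case
    using gen_mat_pingpong by (simp flip: matrix_vector_mul_assoc)
qed simp

lemma reduced_word_mat_eq_one: "reduced ws \<Longrightarrow> word_mat ws = mat 1 \<Longrightarrow> ws = []"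
proof (rule ccontr)
  assume ws: "reduced ws" "word_mat ws = mat 1" "ws \<noteq> []"
  define v :: "int^2" where "v = axis (if fst (last ws) then 1 else 2) 1"
  have "v \<in> pingpong_source (last ws)"
    by (auto simp: v_def pingpong_source_def axis_def)
  from reduced_word_mat_pingpong[OF ws(1,3) this] show False
    using ws(2) by (auto simp: v_def pingpong_target_def axis_def split: if_splits)
qed

lemma word_mat_pump:
  assumes "word_mat (u @ v @ x @ y @ z) = mat 1"
    and "word_mat (u @ v @ x) = word_mat (u @ v)"
    and "word_mat (u @ v @ x @ y) = word_mat u"
  shows "word_mat (u @ v @ v @ x @ y @ y @ z) = mat 1"
proof -
  have "word_mat (u @ v) ** word_mat x = word_mat (u @ v) ** mat 1"
    using assms(2) by (simp only: word_mat_append matrix_mul_rid matrix_mul_assoc)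
  then have x: "word_mat x = mat 1"
    by (rule word_mat_cancel_left)
  have "word_mat u ** (word_mat v ** word_mat y) = word_mat u ** mat 1"
    using assms(3) x by (simp only: word_mat_append matrix_mul_rid matrix_mul_lid matrix_mul_assoc)
  then have vy: "word_mat v ** word_mat y = mat 1"
    by (rule word_mat_cancel_left)
  have "word_mat (u @ v @ v @ x @ y @ y @ z) = word_mat u ** (word_mat v ** (word_mat v ** word_mat y) ** word_mat y) ** word_mat z"
    using x by (simp only: word_mat_append matrix_mul_lid matrix_mul_assoc)
  also have "\<dots> = word_mat u ** (word_mat v ** word_mat x ** word_mat y) ** word_mat z"
    using x vy by (simp only: matrix_mul_lid matrix_mul_rid)
  also have "\<dots> = word_mat (u @ v @ x @ y @ z)"
    by (simp only: word_mat_append matrix_mul_assoc)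
  finally show ?thesis
    using assms(1) by simp
qed

definition cancel_snoc :: "gen list \<Rightarrow> gen \<Rightarrow> gen list" where
  "cancel_snoc st g = (if st \<noteq> [] \<and> last st = gen_inv g then butlast st else st @ [g])"

lemma cancel_snoc_cases:
  obtains (pop) st' where "st = st' @ [gen_inv g]" "cancel_snoc st g = st'"
  | (push) "cancel_snoc st g = st @ [g]" "st \<noteq> [] \<Longrightarrow> g \<noteq> gen_inv (last st)"
proof (cases "st \<noteq> [] \<and> last st = gen_inv g")
  case True
  then have "st = butlast st @ [gen_inv g]"
    by (metis append_butlast_last_id)
  with True show ?thesis
    using pop by (simp add: cancel_snoc_def)
next
  case False
  then have "st \<noteq> [] \<Longrightarrow> g \<noteq> gen_inv (last st)"
    by auto
  with False show ?thesis
    using push by (auto simp: cancel_snoc_def)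
qed

lemma word_mat_cancel_snoc: "word_mat (cancel_snoc st g) = word_mat st ** gen_mat g"
proof (cases st g rule: cancel_snoc_cases)
  case (pop st')
  then show ?thesis
    using gen_mat_mult_gen_inv[of "gen_inv g"] by (simp flip: matrix_mul_assoc)
qed simp

lemma reduced_cancel_snoc: "reduced st \<Longrightarrow> reduced (cancel_snoc st g)"
  by (cases st g rule: cancel_snoc_cases) (auto simp: reduced_def successively_append_iff)

lemma cancel_snoc_push_or_pop:
  "(\<exists>z. cancel_snoc st g = st @ [z]) \<or> (\<exists>z. st = cancel_snoc st g @ [z])"
  by (cases st g rule: cancel_snoc_cases) auto

lemma word_mat_foldl_cancel_snoc: "word_mat (foldl cancel_snoc st gs) = word_mat st ** word_mat gs"
  by (induction gs arbitrary: st) (auto simp: word_mat_cancel_snoc matrix_mul_assoc)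

lemma reduced_foldl_cancel_snoc: "reduced st \<Longrightarrow> reduced (foldl cancel_snoc st gs)"
  by (induction gs arbitrary: st) (auto simp: reduced_cancel_snoc)

section \<open>The Sanov subgroup\<close>

definition sanov_group :: "(int^2^2) set" where
  "sanov_group = {M. det M = 1 \<and> M$1$1 mod 4 = 1 \<and> M$2$2 mod 4 = 1 \<and> even (M$1$2) \<and> even (M$2$1)}"

lemma gen_mat_mult_sanov_group:
  assumes "M \<in> sanov_group"
  shows "gen_mat g ** M \<in> sanov_group"
proof -
  obtain a b c d where M: "M = mat2 a b c d"
    by (rule mat2_cases)
  define s :: int where "s = (if snd g then -2 else 2)"
  have prod: "gen_mat g ** M =
      (if fst g then mat2 a b (s * a + c) (s * b + d) else mat2 (a + s * c) (b + s * d) c d)"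
    by (simp add: M gen_mat_def s_def Let_def)
  have "a mod 4 = 1" "d mod 4 = 1" "even b" "even c"
    using assms by (simp_all add: M sanov_group_def)
  then have "(s * b + d) mod 4 = 1" "(a + s * c) mod 4 = 1" "even (s * a + c)" "even (b + s * d)"
    by (auto simp: s_def elim!: evenE) presburger+
  moreover have "det (gen_mat g ** M) = 1"
    using assms by (simp add: sanov_group_def det_mul)
  ultimately show ?thesis
    using \<open>a mod 4 = 1\<close> \<open>d mod 4 = 1\<close> \<open>even b\<close> \<open>even c\<close>
    unfolding sanov_group_def mem_Collect_eq prod by (cases "fst g") (simp_all del: det_mat2)
qed

lemma sanov_group_descent:
  assumes "M \<in> sanov_group" "M$2$1 \<noteq> 0"
  obtains g where "\<bar>(gen_mat g ** M)$1$1\<bar> + \<bar>(gen_mat g ** M)$2$1\<bar> < \<bar>M$1$1\<bar> + \<bar>M$2$1\<bar>"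
proof -
  obtain a b c d where M: "M = mat2 a b c d"
    by (rule mat2_cases)
  have "a mod 4 = 1" "even c" "c \<noteq> 0"
    using assms by (simp_all add: M sanov_group_def)
  then have "odd a" "even c" "c \<noteq> 0"
    by presburger+
  then have "\<bar>a\<bar> \<noteq> \<bar>c\<bar>"
    by (metis abs_eq_iff even_minus)
  then consider "\<bar>c\<bar> < \<bar>a\<bar>" | "\<bar>a\<bar> < \<bar>c\<bar>"
    by linarith
  then show ?thesis
  proof cases
    case 1
    then have "\<bar>a + (if (0 < a) = (0 < c) then - 2 else 2) * c\<bar> < \<bar>a\<bar>"
      using \<open>c \<noteq> 0\<close> by (auto simp: abs_if)
    then show ?thesis
      using that[of "(False, (0 < a) = (0 < c))"] by (simp add: M gen_mat_def)
  next
    case 2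
    then have "\<bar>c + (if (0 < a) = (0 < c) then - 2 else 2) * a\<bar> < \<bar>c\<bar>"
      using \<open>odd a\<close> by (cases "a = 0") (auto simp: abs_if)
    then show ?thesis
      using that[of "(True, (0 < a) = (0 < c))"] by (simp add: M gen_mat_def)
  qed
qed

lemma word_mat_upper_triangular: "even b \<Longrightarrow> \<exists>ws. word_mat ws = mat2 1 b 0 1"
proof (induction "nat \<bar>b\<bar>" arbitrary: b rule: less_induct)
  case less
  consider "b = 0" | "0 < b" | "b < 0"
    by linarith
  then show ?case
  proof cases
    case 1
    then show ?thesis
      by (intro exI[of _ "[]"]) (simp add: mat2_one)
  next
    case 2
    then obtain ws where "word_mat ws = mat2 1 (b - 2) 0 1"
      using less by fastforce
    then show ?thesis
      by (intro exI[of _ "(False, False) # ws"]) (simp add: gen_mat_def)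
  next
    case 3
    then obtain ws where "word_mat ws = mat2 1 (b + 2) 0 1"
      using less by fastforce
    then show ?thesis
      by (intro exI[of _ "(False, True) # ws"]) (simp add: gen_mat_def)
  qed
qed

lemma sanov_group_word: "M \<in> sanov_group \<Longrightarrow> \<exists>ws. word_mat ws = M"
proof (induction "nat (\<bar>M$1$1\<bar> + \<bar>M$2$1\<bar>)" arbitrary: M rule: less_induct)
  case less
  show ?case
  proof (cases "M$2$1 = 0")
    case True
    obtain a b d where M: "M = mat2 a b 0 d"
      using True mat2_eta by metis
    have "a * d = 1" "a mod 4 = 1" "even b"
      using less.prems by (simp_all add: M sanov_group_def)
    then have "a = 1" "d = 1"
      using zmult_eq_1_iff by fastforce+
    then show ?thesis
      using word_mat_upper_triangular \<open>even b\<close> M by simp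
  next
    case False
    then obtain g where "\<bar>(gen_mat g ** M)$1$1\<bar> + \<bar>(gen_mat g ** M)$2$1\<bar> < \<bar>M$1$1\<bar> + \<bar>M$2$1\<bar>"
      using sanov_group_descent less.prems by blast
    then obtain ws where "word_mat ws = gen_mat g ** M"
      using less gen_mat_mult_sanov_group by fastforce
    then have "word_mat (gen_inv g # ws) = M"
      by simp
    then show ?thesis ..
  qed
qed

lemma sanov_group_nonempty_word:
  assumes "M \<in> sanov_group"
  obtains ws where "ws \<noteq> []" "word_mat ws = M"
proof -
  obtain ws where "word_mat ws = M"
    using sanov_group_word[OF assms] ..
  then show ?thesis
    using that[of "[g, gen_inv g] @ ws" for g] by simp
qed

section \<open>Coset representatives modulo 4\<close>

definition mat_mod :: "int \<Rightarrow> int^'n^'m \<Rightarrow> int^'n^'m" where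
  "mat_mod q M = (\<chi> i j. M $ i $ j mod q)"

lemma matrix_mult_mod:
  "(A ** B) $ i $ j mod q = (\<Sum>k\<in>UNIV. mat_mod q A $ i $ k * mat_mod q B $ k $ j) mod q"
proof -
  have "(\<Sum>k\<in>UNIV. mat_mod q A $ i $ k * mat_mod q B $ k $ j) mod q =
      (\<Sum>k\<in>UNIV. (A $ i $ k * B $ k $ j) mod q) mod q"
    unfolding mat_mod_def by (subst mod_sum_eq[symmetric]) (simp add: mod_mult_eq)
  then show ?thesis
    by (simp add: matrix_matrix_mult_def mod_sum_eq)
qed

lemma mat_mod_mult_cong:
  "mat_mod q A = mat_mod q A' \<Longrightarrow> mat_mod q B = mat_mod q B' \<Longrightarrow>
    mat_mod q (A ** B) = mat_mod q (A' ** B')"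
  by (subst (2) mat_mod_def, subst mat_mod_def) (simp add: matrix_mult_mod)

lemma finite_range_mat_mod:
  assumes "0 < q"
  shows "finite (range (mat_mod q :: int^2^2 \<Rightarrow> int^2^2))"
proof -
  have "range (mat_mod q :: int^2^2 \<Rightarrow> int^2^2) \<subseteq>
      (\<lambda>(a, b, c, d). mat2 a b c d) ` ({0..<q} \<times> {0..<q} \<times> {0..<q} \<times> {0..<q})"
  proof
    fix R assume "R \<in> range (mat_mod q :: int^2^2 \<Rightarrow> int^2^2)"
    then have "R $ i $ j \<in> {0..<q}" for i j
      using assms by (auto simp: mat_mod_def)
    moreover have "R = (\<lambda>(a, b, c, d). mat2 a b c d) (R$1$1, R$1$2, R$2$1, R$2$2)"
      by (simp flip: mat2_eta)
    ultimately show "R \<in> (\<lambda>(a, b, c, d). mat2 a b c d) ` ({0..<q} \<times> {0..<q} \<times> {0..<q} \<times> {0..<q})"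
      by (intro image_eqI[of R _ "(R$1$1, R$1$2, R$2$1, R$2$2)"]) auto
  qed
  then show ?thesis
    by (rule finite_subset) auto
qed

text \<open>The identity class is represented by the identity itself, so that the simulation below
  starts and accepts at labels with representative mat 1.\<close>

definition coset_rep :: "int^2^2 \<Rightarrow> int^2^2" where
  "coset_rep M = (if mat_mod 4 M = mat_mod 4 (mat 1) then mat 1
                  else SOME R. det R = 1 \<and> mat_mod 4 R = mat_mod 4 M)"

lemma coset_rep_one [simp]: "coset_rep (mat 1) = mat 1"
  by (simp add: coset_rep_def)

lemma coset_rep_cong: "mat_mod 4 A = mat_mod 4 B \<Longrightarrow> coset_rep A = coset_rep B"
  by (simp add: coset_rep_def)

lemma coset_rep_spec:
  assumes "det M = 1"
  shows "det (coset_rep M) = 1" "mat_mod 4 (coset_rep M) = mat_mod 4 M"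
proof -
  have "det (coset_rep M) = 1 \<and> mat_mod 4 (coset_rep M) = mat_mod 4 M"
  proof (cases "mat_mod 4 M = mat_mod 4 (mat 1)")
    case False
    have "\<exists>R. det R = 1 \<and> mat_mod 4 R = mat_mod 4 M"
      using assms by blast
    then have "det (SOME R. det R = 1 \<and> mat_mod 4 R = mat_mod 4 M) = 1 \<and>
        mat_mod 4 (SOME R. det R = 1 \<and> mat_mod 4 R = mat_mod 4 M) = mat_mod 4 M"
      by (rule someI_ex)
    then show ?thesis
      using False by (simp add: coset_rep_def)
  qed (simp add: coset_rep_def)
  then show "det (coset_rep M) = 1" "mat_mod 4 (coset_rep M) = mat_mod 4 M"
    by simp_all
qed

lemma finite_range_coset_rep: "finite (range coset_rep)"
proof -
  have "range coset_rep \<subseteq>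
      insert (mat 1) ((\<lambda>P. SOME R. det R = 1 \<and> mat_mod 4 R = P) ` range (mat_mod 4))"
    by (auto simp: coset_rep_def)
  then show ?thesis
    using finite_range_mat_mod[of 4] by (auto intro: finite_subset)
qed

text \<open>M and its representative agree modulo 4, so M times the inverse of the representative is
  congruent to the identity modulo 4.\<close>

lemma mult_adj2_coset_rep:
  assumes "det M = 1"
  shows "M ** adj2 (coset_rep M) \<in> sanov_group"
proof -
  define G where "G = M ** adj2 (coset_rep M)"
  have "mat_mod 4 G = mat_mod 4 (coset_rep M ** adj2 (coset_rep M))"
    unfolding G_def using coset_rep_spec(2)[OF assms] by (intro mat_mod_mult_cong) simp_all
  then have "mat_mod 4 G = mat_mod 4 (mat 1)"
    using mult_adj2[OF coset_rep_spec(1)[OF assms]] by simp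
  then have "G $ 1 $ 1 mod 4 = 1" "G $ 2 $ 2 mod 4 = 1" "G $ 1 $ 2 mod 4 = 0" "G $ 2 $ 1 mod 4 = 0"
    by (simp_all add: mat_mod_def vec_eq_iff mat_def forall_2)
  moreover from this have "even (G $ 1 $ 2)" "even (G $ 2 $ 1)"
    by presburger+
  moreover have "det G = 1"
    using assms coset_rep_spec(1)[OF assms] by (simp add: G_def det_mul)
  ultimately show ?thesis
    by (simp add: sanov_group_def G_def)
qed

section \<open>Simulation by a free-group automaton\<close>

fun lpath :: "'l \<Rightarrow> ('l \<times> 'i \<times> 'l \<times> 'g) list \<Rightarrow> 'l \<Rightarrow> bool" where
  "lpath a [] b \<longleftrightarrow> a = b"
| "lpath a ((l, s, l', g) # xs) b \<longleftrightarrow> l = a \<and> lpath l' xs b"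

definition lpath_end :: "'l \<Rightarrow> ('l \<times> 'i \<times> 'l \<times> 'g) list \<Rightarrow> 'l" where
  "lpath_end a xs = last (a # map (\<lambda>x. fst (snd (snd x))) xs)"

definition opt_list :: "'a option \<Rightarrow> 'a list" where
  "opt_list s = (case s of None \<Rightarrow> [] | Some a \<Rightarrow> [a])"

definition lpath_input :: "('l \<times> 'a option \<times> 'l \<times> 'g) list \<Rightarrow> 'a list" where
  "lpath_input xs = concat (map (\<lambda>x. opt_list (fst (snd x))) xs)"

definition lpath_gens :: "('l \<times> 'i \<times> 'l \<times> 'g) list \<Rightarrow> 'g list" where
  "lpath_gens xs = map (\<lambda>x. snd (snd (snd x))) xs"

lemma lpath_append_iff: "lpath a (xs @ ys) b \<longleftrightarrow> (\<exists>m. lpath a xs m \<and> lpath m ys b)"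
  by (induction a xs b rule: lpath.induct) auto

lemma lpath_snoc_iff: "lpath a (xs @ [(l, s, l', g)]) b \<longleftrightarrow> lpath a xs l \<and> l' = b"
  by (simp add: lpath_append_iff)

lemma lpath_end_eq: "lpath a xs b \<Longrightarrow> b = lpath_end a xs"
  by (induction a xs b rule: lpath.induct) (auto simp: lpath_end_def)

lemma lpath_input_append [simp]: "lpath_input (xs @ ys) = lpath_input xs @ lpath_input ys"
  and lpath_input_Nil [simp]: "lpath_input [] = []"
  and lpath_input_Cons [simp]: "lpath_input ((l, s, l', g) # xs) = opt_list s @ lpath_input xs"
  by (simp_all add: lpath_input_def)

lemma lpath_gens_append [simp]: "lpath_gens (xs @ ys) = lpath_gens xs @ lpath_gens ys"
  and lpath_gens_Nil [simp]: "lpath_gens [] = []"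
  and lpath_gens_Cons [simp]: "lpath_gens ((l, s, l', g) # xs) = g # lpath_gens xs"
  by (simp_all add: lpath_gens_def)

lemma opt_list_simps [simp]: "opt_list None = []" "opt_list (Some a) = [a]"
  by (simp_all add: opt_list_def)

lemma reach_step:
  "reach gmul e \<delta> q0 q w x \<Longrightarrow> (q, s, q', m) \<in> \<delta> \<Longrightarrow> reach gmul e \<delta> q0 q' (w @ opt_list s) (gmul x m)"
  by (cases s) (auto intro: reach.read reach.eps)

definition coset_reps :: "(int^2^2) set" where
  "coset_reps = coset_rep ` {M. det M = 1}"

lemma finite_coset_reps: "finite coset_reps"
  unfolding coset_reps_def by (rule finite_subset[OF _ finite_range_coset_rep]) auto

lemma coset_reps_det: "c \<in> coset_reps \<Longrightarrow> det c = 1"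
  by (auto simp: coset_reps_def coset_rep_spec)

lemma coset_rep_in_coset_reps: "det M = 1 \<Longrightarrow> coset_rep M \<in> coset_reps"
  by (simp add: coset_reps_def)

definition sim_word :: "int^2^2 \<Rightarrow> int^2^2 \<Rightarrow> gen list" where
  "sim_word c m = (SOME ws. ws \<noteq> [] \<and> word_mat ws ** coset_rep (c ** m) = c ** m)"

lemma sim_word_spec:
  assumes "det c = 1" "det m = 1"
  shows "sim_word c m \<noteq> []" "word_mat (sim_word c m) ** coset_rep (c ** m) = c ** m"
proof -
  have det: "det (c ** m) = 1"
    using assms by (simp add: det_mul)
  obtain ws where "ws \<noteq> []" "word_mat ws = c ** m ** adj2 (coset_rep (c ** m))"
    using sanov_group_nonempty_word[OF mult_adj2_coset_rep[OF det]] .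
  then have "ws \<noteq> [] \<and> word_mat ws ** coset_rep (c ** m) = c ** m"
    using adj2_mult[OF coset_rep_spec(1)[OF det]] by (simp flip: matrix_mul_assoc)
  then have "sim_word c m \<noteq> [] \<and> word_mat (sim_word c m) ** coset_rep (c ** m) = c ** m"
    unfolding sim_word_def by (rule someI)
  then show "sim_word c m \<noteq> []" "word_mat (sim_word c m) ** coset_rep (c ** m) = c ** m"
    by simp_all
qed

type_synonym sl2_trans = "nat \<times> nat option \<times> nat \<times> (int^2^2)"

text \<open>A transition (q, s, q', m), taken in state q with coset representative c, is simulated by a
  chain of steps from State q c to State q' (coset_rep (c ** m)): the first step reads s, and the
  steps multiply in the generators of sim_word c m one at a time, passing the labels
  Inner (q, s, q', m) c k in between.\<close>

datatype sim_label = State nat "int^2^2" | Inner sl2_trans "int^2^2" nat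

fun sim_label_at :: "sl2_trans \<Rightarrow> int^2^2 \<Rightarrow> nat \<Rightarrow> sim_label" where
  "sim_label_at (q, s, q', m) c k =
     (if k = 0 then State q c
      else if k = length (sim_word c m) then State q' (coset_rep (c ** m))
      else Inner (q, s, q', m) c k)"

fun sim_step :: "sl2_trans \<Rightarrow> int^2^2 \<Rightarrow> nat \<Rightarrow> sim_label \<times> nat option \<times> sim_label \<times> gen" where
  "sim_step (q, s, q', m) c k =
     (sim_label_at (q, s, q', m) c k, if k = 0 then s else None,
      sim_label_at (q, s, q', m) c (Suc k), sim_word c m ! k)"

definition sim_steps :: "sl2_trans set \<Rightarrow> (sim_label \<times> nat option \<times> sim_label \<times> gen) set" where
  "sim_steps \<delta> = {sim_step (q, s, q', m) c k | q s q' m c k.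
      (q, s, q', m) \<in> \<delta> \<and> c \<in> coset_reps \<and> k < length (sim_word c m)}"

definition sim_labels :: "nat set \<Rightarrow> sl2_trans set \<Rightarrow> sim_label set" where
  "sim_labels Q \<delta> = {State q c | q c. q \<in> Q \<and> c \<in> coset_reps} \<union>
      {Inner (q, s, q', m) c k | q s q' m c k. (q, s, q', m) \<in> \<delta> \<and> c \<in> coset_reps \<and> k < length (sim_word c m)}"

lemma finite_sim_labels: "finite Q \<Longrightarrow> finite \<delta> \<Longrightarrow> finite (sim_labels Q \<delta>)"
proof -
  assume fin: "finite Q" "finite \<delta>"
  have "{State q c | q c. q \<in> Q \<and> c \<in> coset_reps} = (\<lambda>(q, c). State q c) ` (Q \<times> coset_reps)"
    by auto
  moreover have "{Inner (q, s, q', m) c k | q s q' m c k. (q, s, q', m) \<in> \<delta> \<and> c \<in> coset_reps \<and> k < length (sim_word c m)} =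
      (\<Union>t\<in>\<delta>. \<Union>c\<in>coset_reps. Inner t c ` {..<length (sim_word c (snd (snd (snd t))))})"
    by force
  ultimately show ?thesis
    unfolding sim_labels_def using fin finite_coset_reps by auto
qed

lemma sim_steps_target:
  assumes "x \<in> sim_steps \<delta>" "\<forall>(q, s, q', m)\<in>\<delta>. q' \<in> Q \<and> det m = 1"
  shows "fst (snd (snd x)) \<in> sim_labels Q \<delta>"
proof -
  obtain q s q' m c k where x: "x = sim_step (q, s, q', m) c k" and t: "(q, s, q', m) \<in> \<delta>"
    and c: "c \<in> coset_reps" and k: "k < length (sim_word c m)"
    using assms(1) by (auto simp: sim_steps_def)
  have "det (c ** m) = 1"
    using assms(2) t coset_reps_det[OF c] by (auto simp: det_mul)
  then show ?thesis
    using x t c k assms(2) coset_rep_in_coset_reps by (auto simp: sim_labels_def)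
qed

definition free_accepts :: "('l \<times> 'i \<times> 'l \<times> gen) set \<Rightarrow> 'l \<Rightarrow> 'l \<Rightarrow> ('l \<times> 'i \<times> 'l \<times> gen) list \<Rightarrow> bool" where
  "free_accepts \<Delta> a b xs \<longleftrightarrow> lpath a xs b \<and> set xs \<subseteq> \<Delta> \<and> word_mat (lpath_gens xs) = mat 1"

type_synonym sim_path = "(sim_label \<times> nat option \<times> sim_label \<times> gen) list"

fun in_block :: "sl2_trans set \<Rightarrow> nat \<Rightarrow> sl2_trans \<Rightarrow> int^2^2 \<Rightarrow> nat \<Rightarrow> sim_path \<Rightarrow> bool" where
  "in_block \<delta> q0 (q, s, q', m) c k xs \<longleftrightarrow>
     (\<exists>w P. reach (**) (mat 1) \<delta> q0 q w (P ** c) \<and>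
        lpath_input xs = w @ (if k = 0 then [] else opt_list s) \<and>
        word_mat (lpath_gens xs) = P ** word_mat (take k (sim_word c m)))"

fun sim_inv :: "sl2_trans set \<Rightarrow> nat \<Rightarrow> sim_label \<Rightarrow> sim_path \<Rightarrow> bool" where
  "sim_inv \<delta> q0 (State q c) xs \<longleftrightarrow> reach (**) (mat 1) \<delta> q0 q (lpath_input xs) (word_mat (lpath_gens xs) ** c)"
| "sim_inv \<delta> q0 (Inner t c k) xs \<longleftrightarrow> in_block \<delta> q0 t c k xs"

lemma in_block_Suc:
  assumes "in_block \<delta> q0 (q, s, q', m) c k xs" "k < length (sim_word c m)"
  shows "in_block \<delta> q0 (q, s, q', m) c (Suc k) (xs @ [sim_step (q, s, q', m) c k])"
proof -
  obtain w P where wP: "reach (**) (mat 1) \<delta> q0 q w (P ** c)"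
    "lpath_input xs = w @ (if k = 0 then [] else opt_list s)"
    "word_mat (lpath_gens xs) = P ** word_mat (take k (sim_word c m))"
    using assms(1) by auto
  have "take (Suc k) (sim_word c m) = take k (sim_word c m) @ [sim_word c m ! k]"
    using assms(2) by (simp add: take_Suc_conv_app_nth)
  then have "word_mat (lpath_gens (xs @ [sim_step (q, s, q', m) c k])) = P ** word_mat (take (Suc k) (sim_word c m))"
    using wP(3) by (simp add: matrix_mul_assoc)
  then show ?thesis
    using wP(1,2) by auto
qed

lemma in_block_finish:
  assumes "in_block \<delta> q0 (q, s, q', m) c (length (sim_word c m)) xs"
    and "(q, s, q', m) \<in> \<delta>" "det c = 1" "det m = 1"
  shows "sim_inv \<delta> q0 (State q' (coset_rep (c ** m))) xs"
proof -
  obtain w P where wP: "reach (**) (mat 1) \<delta> q0 q w (P ** c)"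
    "lpath_input xs = w @ opt_list s" "word_mat (lpath_gens xs) = P ** word_mat (sim_word c m)"
    using assms(1) sim_word_spec(1)[OF assms(3,4)] by auto
  have "P ** c ** m = word_mat (lpath_gens xs) ** coset_rep (c ** m)"
    using sim_word_spec(2)[OF assms(3,4)] wP(3) by (simp flip: matrix_mul_assoc)
  then show ?thesis
    using reach_step[OF wP(1) assms(2)] wP(2) by simp
qed

lemma sim_inv_block:
  assumes "sim_inv \<delta> q0 (sim_label_at (q, s, q', m) c k) xs" "k < length (sim_word c m)"
  shows "in_block \<delta> q0 (q, s, q', m) c k xs"
proof (cases "k = 0")
  case True
  then show ?thesis
    using assms(1) by (intro in_block.simps[THEN iffD2] exI[of _ "lpath_input xs"]) auto
qed (use assms in auto)

lemma sim_sound: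
  assumes dets: "\<forall>(q, s, q', m)\<in>\<delta>. det m = 1"
  shows "lpath (State q0 (mat 1)) xs l \<Longrightarrow> set xs \<subseteq> sim_steps \<delta> \<Longrightarrow> sim_inv \<delta> q0 l xs"
proof (induction xs arbitrary: l rule: rev_induct)
  case Nil
  then show ?case
    by (auto intro: reach.start)
next
  case (snoc x xs)
  obtain q s q' m c k where x: "x = sim_step (q, s, q', m) c k" and t: "(q, s, q', m) \<in> \<delta>"
    and c: "c \<in> coset_reps" and k: "k < length (sim_word c m)"
    using snoc.prems(2) by (auto simp: sim_steps_def)
  have det: "det c = 1" "det m = 1"
    using coset_reps_det[OF c] dets t by auto
  have "lpath (State q0 (mat 1)) xs (sim_label_at (q, s, q', m) c k)"
    and l: "l = sim_label_at (q, s, q', m) c (Suc k)"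
    using snoc.prems(1) by (simp_all add: x lpath_snoc_iff del: sim_label_at.simps)
  then have "sim_inv \<delta> q0 (sim_label_at (q, s, q', m) c k) xs"
    using snoc.IH snoc.prems(2) by simp
  then have "in_block \<delta> q0 (q, s, q', m) c k xs"
    using k by (rule sim_inv_block)
  then have blk: "in_block \<delta> q0 (q, s, q', m) c (Suc k) (xs @ [x])"
    unfolding x using k by (rule in_block_Suc)
  show ?case
  proof (cases "Suc k = length (sim_word c m)")
    case True
    then show ?thesis
      using in_block_finish[OF blk[unfolded True] t det] l sim_word_spec(1)[OF det] by simp
  qed (use blk l in \<open>simp del: in_block.simps\<close>)
qed

lemma lpath_upt: "lpath (f 0) (map (\<lambda>k. (f k, h k, f (Suc k), g k)) [0..<n]) (f n)"
  by (induction n) (auto simp: lpath_append_iff)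

lemma sim_block:
  assumes "(q, s, q', m) \<in> \<delta>" "c \<in> coset_reps" "det m = 1"
  defines "ys \<equiv> map (sim_step (q, s, q', m) c) [0..<length (sim_word c m)]"
  shows "lpath (State q c) ys (State q' (coset_rep (c ** m)))" "set ys \<subseteq> sim_steps \<delta>"
    "lpath_input ys = opt_list s" "lpath_gens ys = sim_word c m"
proof -
  have ne: "sim_word c m \<noteq> []"
    using sim_word_spec(1) coset_reps_det[OF assms(2)] assms(3) by blast
  have "ys = map (\<lambda>k. (sim_label_at (q, s, q', m) c k, if k = 0 then s else None,
      sim_label_at (q, s, q', m) c (Suc k), sim_word c m ! k)) [0..<length (sim_word c m)]"
    by (simp add: ys_def del: sim_label_at.simps)
  then have "lpath (sim_label_at (q, s, q', m) c 0) ys (sim_label_at (q, s, q', m) c (length (sim_word c m)))"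
    using lpath_upt[of "sim_label_at (q, s, q', m) c" "\<lambda>k. if k = 0 then s else None"
        "\<lambda>k. sim_word c m ! k" "length (sim_word c m)"] by (simp only:)
  then show "lpath (State q c) ys (State q' (coset_rep (c ** m)))"
    using ne by simp
  show "set ys \<subseteq> sim_steps \<delta>"
  proof
    fix y
    assume "y \<in> set ys"
    then obtain k where "k < length (sim_word c m)" "y = sim_step (q, s, q', m) c k"
      by (auto simp: ys_def simp del: sim_step.simps)
    then show "y \<in> sim_steps \<delta>"
      unfolding sim_steps_def using assms(1,2) by blast
  qed
  have "[0..<length (sim_word c m)] = 0 # [1..<length (sim_word c m)]"
    using ne by (simp add: upt_conv_Cons)
  then show "lpath_input ys = opt_list s"
    by (simp add: ys_def lpath_input_def)
  show "lpath_gens ys = sim_word c m"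
    by (simp add: ys_def lpath_gens_def comp_def map_nth)
qed

definition sim_run :: "sl2_trans set \<Rightarrow> sim_label \<Rightarrow> nat \<Rightarrow> nat list \<Rightarrow> int^2^2 \<Rightarrow> bool" where
  "sim_run \<delta> a q w x \<longleftrightarrow> det x = 1 \<and>
     (\<exists>xs. lpath a xs (State q (coset_rep x)) \<and> set xs \<subseteq> sim_steps \<delta> \<and>
        lpath_input xs = w \<and> word_mat (lpath_gens xs) ** coset_rep x = x)"

lemma sim_run_step:
  assumes t: "(q, s, q', m) \<in> \<delta>" "det m = 1" and run: "sim_run \<delta> a q w x"
  shows "sim_run \<delta> a q' (w @ opt_list s) (x ** m)"
proof -
  obtain xs where x: "det x = 1" and xs: "lpath a xs (State q (coset_rep x))" "set xs \<subseteq> sim_steps \<delta>"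
    "lpath_input xs = w" "word_mat (lpath_gens xs) ** coset_rep x = x"
    using run by (auto simp: sim_run_def)
  define c where "c = coset_rep x"
  have c: "c \<in> coset_reps" "det c = 1"
    using x coset_rep_spec(1) coset_rep_in_coset_reps by (auto simp: c_def)
  define ys where "ys = map (sim_step (q, s, q', m) c) [0..<length (sim_word c m)]"
  note blk = sim_block[OF t(1) c(1) t(2), folded ys_def]
  have rep: "coset_rep (c ** m) = coset_rep (x ** m)"
    using coset_rep_spec(2)[OF x] by (auto simp: c_def intro: coset_rep_cong mat_mod_mult_cong)
  have "lpath a (xs @ ys) (State q' (coset_rep (x ** m)))"
    using xs(1) blk(1) rep unfolding c_def lpath_append_iff by auto
  moreover have "word_mat (lpath_gens (xs @ ys)) ** coset_rep (x ** m) = x ** m"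
  proof -
    have "word_mat (lpath_gens (xs @ ys)) ** coset_rep (x ** m) =
        word_mat (lpath_gens xs) ** (word_mat (sim_word c m) ** coset_rep (c ** m))"
      using blk(4) rep by (simp flip: matrix_mul_assoc)
    also have "\<dots> = word_mat (lpath_gens xs) ** c ** m"
      using sim_word_spec(2)[OF c(2) t(2)] by (simp add: matrix_mul_assoc)
    finally show ?thesis
      using xs(4) by (simp add: c_def)
  qed
  moreover have "det (x ** m) = 1"
    using x t(2) by (simp add: det_mul)
  ultimately show ?thesis
    unfolding sim_run_def using xs(2,3) blk(2,3) by (intro conjI exI[of _ "xs @ ys"]) auto
qed

lemma sim_complete:
  assumes dets: "\<forall>(q, s, q', m)\<in>\<delta>. det m = 1"
  shows "reach (**) (mat 1) \<delta> q0 q w x \<Longrightarrow> sim_run \<delta> (State q0 (mat 1)) q w x"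
proof (induction rule: reach.induct)
  case start
  show ?case
    unfolding sim_run_def by (intro conjI exI[of _ "[]"]) simp_all
next
  case (read q w x a q' m)
  then show ?case
    using sim_run_step[of q "Some a" q' m] dets by fastforce
next
  case (eps q w x q' m)
  then show ?case
    using sim_run_step[of q None q' m] dets by fastforce
qed

theorem sim_accepts_iff:
  assumes "\<forall>(q, s, q', m)\<in>\<delta>. det m = 1"
  shows "reach (**) (mat 1) \<delta> q0 q w (mat 1) \<longleftrightarrow>
    (\<exists>xs. free_accepts (sim_steps \<delta>) (State q0 (mat 1)) (State q (mat 1)) xs \<and> lpath_input xs = w)"
proof
  assume "reach (**) (mat 1) \<delta> q0 q w (mat 1)"
  then have "sim_run \<delta> (State q0 (mat 1)) q w (mat 1)"
    by (rule sim_complete[OF assms])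
  then show "\<exists>xs. free_accepts (sim_steps \<delta>) (State q0 (mat 1)) (State q (mat 1)) xs \<and> lpath_input xs = w"
    by (auto simp: sim_run_def free_accepts_def)
next
  assume "\<exists>xs. free_accepts (sim_steps \<delta>) (State q0 (mat 1)) (State q (mat 1)) xs \<and> lpath_input xs = w"
  then obtain xs where "lpath (State q0 (mat 1)) xs (State q (mat 1))" "set xs \<subseteq> sim_steps \<delta>"
    "word_mat (lpath_gens xs) = mat 1" "lpath_input xs = w"
    by (auto simp: free_accepts_def)
  then show "reach (**) (mat 1) \<delta> q0 q w (mat 1)"
    using sim_sound[OF assms] by fastforce
qed

section \<open>Stack walks\<close>

fun read_bound :: "nat \<Rightarrow> nat \<Rightarrow> nat" where
  "read_bound K 0 = 0"
| "read_bound K (Suc h) = K * (2 + read_bound K h)"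

text \<open>The abstraction of an accepting run of a free-group automaton: labels are its states, stacks
  are the freely reduced register words, and rd p is the number of letters read in step p. The
  last assumption is what pumping yields when the accepted language is unpumpable.\<close>

locale stack_walk =
  fixes N :: nat and lab :: "nat \<Rightarrow> 'l" and stk :: "nat \<Rightarrow> 'g list" and rd :: "nat \<Rightarrow> nat"
    and \<Lambda> :: "'l set"
  assumes finite_labels: "finite \<Lambda>"
    and lab_in_labels: "p \<le> N \<Longrightarrow> lab p \<in> \<Lambda>"
    and stk_step: "p < N \<Longrightarrow> (\<exists>z. stk (Suc p) = stk p @ [z]) \<or> (\<exists>z. stk p = stk (Suc p) @ [z])"
    and rd_le_1: "p < N \<Longrightarrow> rd p \<le> 1"
    and loops_read_nothing: "i \<le> j \<Longrightarrow> j \<le> k \<Longrightarrow> k \<le> l \<Longrightarrow> l \<le> N \<Longrightarrow> lab i = lab j \<Longrightarrow> lab k = lab l \<Longrightarrow>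
      stk i = stk l \<Longrightarrow> stk j = stk k \<Longrightarrow> sum rd {i..<j} + sum rd {k..<l} = 0"
begin

definition reads :: "nat \<Rightarrow> nat \<Rightarrow> nat" where
  "reads a b = sum rd {a..<b}"

lemma reads_split: "a \<le> b \<Longrightarrow> b \<le> c \<Longrightarrow> reads a c = reads a b + reads b c"
  unfolding reads_def by (simp add: sum.atLeastLessThan_concat)

lemma reads_mono: "a \<le> a' \<Longrightarrow> a' \<le> b' \<Longrightarrow> b' \<le> b \<Longrightarrow> reads a' b' \<le> reads a b"
  unfolding reads_def by (intro sum_mono2) auto

lemma reads_same_label:
  "t \<le> e \<Longrightarrow> e \<le> N \<Longrightarrow> lab t = lab e \<Longrightarrow> stk t = stk e \<Longrightarrow> reads t e = 0"
  using loops_read_nothing[of t e e e] by (simp add: reads_def)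

lemma stk_Suc_neq: "p < N \<Longrightarrow> stk (Suc p) \<noteq> stk p"
  using stk_step[of p] by auto

definition balanced :: "nat \<Rightarrow> nat \<Rightarrow> bool" where
  "balanced s e \<longleftrightarrow> s \<le> e \<and> e \<le> N \<and> stk s = stk e \<and> (\<forall>p. s \<le> p \<and> p \<le> e \<longrightarrow> prefix (stk s) (stk p))"

definition excursion :: "nat \<Rightarrow> nat \<Rightarrow> bool" where
  "excursion r e \<longleftrightarrow> r < e \<and> balanced r e \<and> (\<forall>t. r < t \<and> t < e \<longrightarrow> stk t \<noteq> stk r)"

lemma excursion_longer:
  assumes "excursion r e" "r < t" "t < e"
  shows "length (stk r) < length (stk t)"
proof -
  have "prefix (stk r) (stk t)" "stk t \<noteq> stk r"
    using assms by (auto simp: excursion_def balanced_def)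
  then show ?thesis
    by (metis prefix_length_less prefix_order.dual_order.not_eq_order_implies_strict)
qed

lemma excursion_push:
  assumes "excursion r e"
  obtains z where "Suc r < e" "stk (Suc r) = stk r @ [z]"
proof -
  have "r < e" "r < N" "stk e = stk r"
    using assms by (auto simp: excursion_def balanced_def)
  then have "Suc r < e"
    using stk_Suc_neq[of r] by (metis Suc_lessI)
  moreover from this have "length (stk r) < length (stk (Suc r))"
    using assms excursion_longer by simp
  ultimately show ?thesis
    using that stk_step[OF \<open>r < N\<close>] by auto
qed

lemma excursion_above:
  assumes "excursion r e" "stk (Suc r) = stk r @ [z]" "Suc r \<le> t" "t < e"
  shows "prefix (stk r @ [z]) (stk t)"
  using assms(3,4)
proof (induction t rule: dec_induct)
  case base
  then show ?case
    using assms(2) by simp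
next
  case (step t)
  have "t < N" "length (stk r) < length (stk (Suc t))"
    using step assms(1) excursion_longer[OF assms(1), of "Suc t"] by (auto simp: excursion_def balanced_def)
  with stk_step[OF \<open>t < N\<close>] step show ?case
    by (auto intro: prefix_length_prefix simp: prefix_order.trans)
qed

lemma excursion_pop:
  assumes "excursion r e" "stk (Suc r) = stk r @ [z]"
  shows "stk (e - 1) = stk r @ [z]"
proof -
  have "Suc r < e" "e \<le> N" "stk e = stk r"
    using assms excursion_push by (auto simp: excursion_def balanced_def)
  then have above: "prefix (stk r @ [z]) (stk (e - 1))" and "e - 1 < N" and "Suc (e - 1) = e"
    using excursion_above[OF assms, of "e - 1"] by auto
  with stk_step[OF \<open>e - 1 < N\<close>] \<open>stk e = stk r\<close> show ?thesis
    by (auto dest: prefix_length_le)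
qed

lemma excursion_reads:
  assumes "excursion r e"
  shows "balanced (Suc r) (e - 1)" "reads r e \<le> 2 + reads (Suc r) (e - 1)"
proof -
  obtain z where z: "Suc r < e" "stk (Suc r) = stk r @ [z]"
    using excursion_push[OF assms] .
  show "balanced (Suc r) (e - 1)"
    using z assms excursion_above[OF assms z(2)] excursion_pop[OF assms z(2)]
    by (auto simp: balanced_def excursion_def)
  have "e \<le> N"
    using assms by (simp add: excursion_def balanced_def)
  moreover have "{e - 1..<e} = {e - 1}"
    using z by auto
  ultimately have "reads r e = rd r + reads (Suc r) (e - 1) + rd (e - 1)"
    using z reads_split[of r "Suc r" e] reads_split[of "Suc r" "e - 1" e] by (simp add: reads_def)
  moreover have "rd r \<le> 1" "rd (e - 1) \<le> 1"
    using rd_le_1 z \<open>e \<le> N\<close> by auto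
  ultimately show "reads r e \<le> 2 + reads (Suc r) (e - 1)"
    by simp
qed

definition returns :: "nat \<Rightarrow> nat \<Rightarrow> nat set" where
  "returns j e = {t. j \<le> t \<and> t \<le> e \<and> stk t = stk j}"

lemma finite_returns: "finite (returns j e)"
  unfolding returns_def by (rule finite_subset[of _ "{..e}"]) auto

lemma last_return:
  assumes "j < e"
  shows "\<exists>r. j \<le> r \<and> r < e \<and> stk r = stk j \<and> (\<forall>t. r < t \<and> t < e \<longrightarrow> stk t \<noteq> stk j)"
proof -
  define R where "R = {t. j \<le> t \<and> t < e \<and> stk t = stk j}"
  have "finite R" "j \<in> R"
    using assms by (auto simp: R_def intro: finite_subset[of _ "{..<e}"])
  then have max: "Max R \<in> R" "\<And>t. t \<in> R \<Longrightarrow> t \<le> Max R"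
    using Max_in by auto
  have "\<forall>t. Max R < t \<and> t < e \<longrightarrow> stk t \<noteq> stk j"
  proof (intro allI impI notI)
    fix t
    assume t: "Max R < t \<and> t < e" "stk t = stk j"
    then have "t \<in> R"
      using max(1) by (auto simp: R_def)
    then show False
      using max(2) t(1) by fastforce
  qed
  with max(1) show ?thesis
    unfolding R_def by blast
qed

lemma reads_by_returns:
  assumes "balanced j k"
    and X: "\<And>r e. j \<le> r \<Longrightarrow> e \<le> k \<Longrightarrow> stk r = stk j \<Longrightarrow> excursion r e \<Longrightarrow> reads r e \<le> X"
  shows "j \<le> e \<Longrightarrow> e \<le> k \<Longrightarrow> stk e = stk j \<Longrightarrow> reads j e + X \<le> card (lab ` returns j e) * X"
proof (induction e rule: less_induct)
  case (less e)
  show ?case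
  proof (cases "e = j")
    case True
    then have "returns j e = {j}"
      by (auto simp: returns_def)
    then show ?thesis
      using True by (simp add: reads_def)
  next
    case False
    then have "j < e"
      using less.prems(1) by simp
    then obtain r where r: "j \<le> r" "r < e" "stk r = stk j" "\<forall>t. r < t \<and> t < e \<longrightarrow> stk t \<noteq> stk j"
      using last_return by blast
    have IH: "reads j r + X \<le> card (lab ` returns j r) * X"
      using less.IH r less.prems by simp
    have "excursion r e"
      using assms(1) r less.prems by (auto simp: excursion_def balanced_def)
    then have "reads r e \<le> X"
      using X r less.prems by simp
    have split: "reads j e = reads j r + reads r e"
      using reads_split[of j r e] r by simp
    have sub: "returns j r \<subseteq> returns j e"
      using r by (auto simp: returns_def)
    show ?thesis
    proof (cases "reads r e = 0")
      case True
      have "card (lab ` returns j r) \<le> card (lab ` returns j e)"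
        using sub finite_returns by (intro card_mono) auto
      then have "card (lab ` returns j r) * X \<le> card (lab ` returns j e) * X"
        by (rule mult_le_mono1)
      then show ?thesis
        using IH split True by linarith
    next
      case False
      have "lab e \<notin> lab ` returns j r"
      proof
        assume "lab e \<in> lab ` returns j r"
        then obtain t where "t \<in> returns j r" "lab t = lab e"
          by auto
        then have "reads t e = 0"
          using reads_same_label[of t e] r less.prems assms(1) by (auto simp: returns_def balanced_def)
        moreover have "reads r e \<le> reads t e"
          using reads_mono \<open>t \<in> returns j r\<close> r by (auto simp: returns_def)
        ultimately show False
          using False by simp
      qed
      moreover have "insert (lab e) (lab ` returns j r) \<subseteq> lab ` returns j e"
        using sub less.prems by (auto simp: returns_def)
      ultimately have "card (lab ` returns j r) + 1 \<le> card (lab ` returns j e)"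
        using finite_returns card_mono[of "lab ` returns j e" "insert (lab e) (lab ` returns j r)"] by simp
      then have "(card (lab ` returns j r) + 1) * X \<le> card (lab ` returns j e) * X"
        by (rule mult_le_mono1)
      then have "card (lab ` returns j r) * X + X \<le> card (lab ` returns j e) * X"
        by (simp add: add_mult_distrib)
      then show ?thesis
        using IH split \<open>reads r e \<le> X\<close> by linarith
    qed
  qed
qed

lemma reads_balanced_le_card:
  assumes "balanced j k"
    and "\<And>r e. j \<le> r \<Longrightarrow> e \<le> k \<Longrightarrow> stk r = stk j \<Longrightarrow> excursion r e \<Longrightarrow> reads r e \<le> X"
  shows "reads j k \<le> card \<Lambda> * X"
proof -
  have "j \<le> k" "stk k = stk j"
    using assms(1) by (simp_all add: balanced_def)
  then have "reads j k + X \<le> card (lab ` returns j k) * X"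
    by (intro reads_by_returns[OF assms]) simp_all
  moreover have "card (lab ` returns j k) \<le> card \<Lambda>"
    using assms(1) lab_in_labels finite_labels by (intro card_mono) (auto simp: returns_def balanced_def)
  then have "card (lab ` returns j k) * X \<le> card \<Lambda> * X"
    by (rule mult_le_mono1)
  ultimately show ?thesis
    by linarith
qed

definition balanced_pairs :: "nat \<Rightarrow> nat \<Rightarrow> ('l \<times> 'l) set" where
  "balanced_pairs s e = {(lab i, lab l) | i l. s \<le> i \<and> i \<le> l \<and> l \<le> e \<and> balanced i l}"

lemma finite_balanced_pairs: "e \<le> N \<Longrightarrow> finite (balanced_pairs s e)"
  by (rule finite_subset[of _ "\<Lambda> \<times> \<Lambda>"])
    (auto simp: balanced_pairs_def balanced_def finite_labels intro: lab_in_labels)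

lemma minimal_balanced:
  assumes "balanced s e"
  obtains j k where "s \<le> j" "j \<le> k" "k \<le> e" "balanced j k" "(lab j, lab k) = (lab s, lab e)"
    "\<And>a b. s \<le> a \<Longrightarrow> a \<le> b \<Longrightarrow> b \<le> e \<Longrightarrow> balanced a b \<Longrightarrow> (lab a, lab b) = (lab s, lab e) \<Longrightarrow>
      k - j \<le> b - a"
proof -
  let ?P = "\<lambda>(a, b). s \<le> a \<and> a \<le> b \<and> b \<le> e \<and> balanced a b \<and> (lab a, lab b) = (lab s, lab e)"
  have "s \<le> e"
    using assms by (simp add: balanced_def)
  then have "?P (s, e)"
    using assms by simp
  then obtain jk where "?P jk" "\<forall>ab. ?P ab \<longrightarrow> snd jk - fst jk \<le> snd ab - fst ab"
    using ex_has_least_nat[of ?P "(s, e)" "\<lambda>(a, b). b - a"] by (auto simp: case_prod_beta)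
  then show ?thesis
    using that[of "fst jk" "snd jk"] by (auto simp: case_prod_beta)
qed

text \<open>A shortest balanced subsegment with the same end labels reads as much as the whole segment,
  and the excursions inside it have strictly fewer label pairs.\<close>

lemma reads_balanced_bound:
  "balanced s e \<Longrightarrow> card (balanced_pairs s e) \<le> h \<Longrightarrow> reads s e \<le> read_bound (card \<Lambda>) h"
proof (induction h arbitrary: s e)
  case 0
  then have "(lab s, lab e) \<in> balanced_pairs s e" "finite (balanced_pairs s e)"
    using finite_balanced_pairs by (auto simp: balanced_pairs_def balanced_def)
  then show ?case
    using 0 by (auto simp: card_gt_0_iff)
next
  case (Suc h)
  obtain j k where jk: "s \<le> j" "j \<le> k" "k \<le> e" "balanced j k" "(lab j, lab k) = (lab s, lab e)"
    and minimal: "\<And>a b. s \<le> a \<Longrightarrow> a \<le> b \<Longrightarrow> b \<le> e \<Longrightarrow> balanced a b \<Longrightarrow>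
      (lab a, lab b) = (lab s, lab e) \<Longrightarrow> k - j \<le> b - a"
    using minimal_balanced[OF Suc.prems(1)] by blast
  have "e \<le> N" "stk s = stk e" "stk j = stk k"
    using Suc.prems(1) jk(4) by (simp_all add: balanced_def)
  then have "reads s j = 0" "reads k e = 0"
    using loops_read_nothing[of s j k e] jk by (simp_all add: reads_def)
  then have "reads s e = reads j k"
    using reads_split[of s j e] reads_split[of j k e] jk by simp
  also have "\<dots> \<le> card \<Lambda> * (2 + read_bound (card \<Lambda>) h)"
  proof (rule reads_balanced_le_card[OF jk(4)])
    fix r e'
    assume r: "j \<le> r" "e' \<le> k" "stk r = stk j" and exc: "excursion r e'"
    note inner = excursion_reads[OF exc]
    have "balanced_pairs (Suc r) (e' - 1) \<subseteq> balanced_pairs s e - {(lab s, lab e)}"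
    proof
      fix p
      assume "p \<in> balanced_pairs (Suc r) (e' - 1)"
      then obtain a b where p: "p = (lab a, lab b)" "Suc r \<le> a" "a \<le> b" "b \<le> e' - 1" "balanced a b"
        by (auto simp: balanced_pairs_def)
      have "r < e'"
        using exc by (simp add: excursion_def)
      then have "b - a < k - j"
        using p r jk by linarith
      then have "p \<noteq> (lab s, lab e)"
        using minimal[of a b] p r jk \<open>r < e'\<close> by fastforce
      moreover have "p \<in> balanced_pairs s e"
        using p r jk \<open>r < e'\<close> unfolding balanced_pairs_def by (intro CollectI exI[of _ a] exI[of _ b]) auto
      ultimately show "p \<in> balanced_pairs s e - {(lab s, lab e)}"
        by simp
    qed
    then have "card (balanced_pairs (Suc r) (e' - 1)) \<le> card (balanced_pairs s e - {(lab s, lab e)})"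
      using finite_balanced_pairs[OF \<open>e \<le> N\<close>] by (intro card_mono) auto
    also have "\<dots> = card (balanced_pairs s e) - 1"
      using Suc.prems(1) by (intro card_Diff_singleton) (auto simp: balanced_pairs_def balanced_def)
    finally have "card (balanced_pairs (Suc r) (e' - 1)) \<le> h"
      using Suc.prems(2) by simp
    then show "reads r e' \<le> 2 + read_bound (card \<Lambda>) h"
      using Suc.IH inner by fastforce
  qed
  finally show ?case
    by simp
qed

theorem reads_bound:
  assumes "stk 0 = []" "stk N = []"
  shows "reads 0 N \<le> read_bound (card \<Lambda>) (card \<Lambda> * card \<Lambda>)"
proof (rule reads_balanced_bound)
  show "balanced 0 N"
    using assms by (simp add: balanced_def)
  have "balanced_pairs 0 N \<subseteq> \<Lambda> \<times> \<Lambda>"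
    by (auto simp: balanced_pairs_def balanced_def intro: lab_in_labels)
  then show "card (balanced_pairs 0 N) \<le> card \<Lambda> * card \<Lambda>"
    using card_mono[of "\<Lambda> \<times> \<Lambda>"] finite_labels by (simp add: card_cartesian_product)
qed

end

section \<open>Accepting runs with unpumpable input\<close>

definition unpumpable :: "'a list set \<Rightarrow> bool" where
  "unpumpable L \<longleftrightarrow>
     (\<forall>u v x y z. u @ v @ x @ y @ z \<in> L \<longrightarrow> u @ v @ v @ x @ y @ y @ z \<in> L \<longrightarrow> v = [] \<and> y = [])"

lemma lpath_end_in_targets: "lpath_end a xs \<in> insert a ((\<lambda>x. fst (snd (snd x))) ` set xs)"
  using last_in_set[of "a # map (\<lambda>x. fst (snd (snd x))) xs"] by (simp add: lpath_end_def)

lemma lpath_pump: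
  assumes "lpath a (u @ v @ x @ y @ z) b"
    and "lpath_end a u = lpath_end a (u @ v)" "lpath_end a (u @ v @ x) = lpath_end a (u @ v @ x @ y)"
  shows "lpath a (u @ v @ v @ x @ y @ y @ z) b"
proof -
  obtain m1 m2 m3 m4 where m: "lpath a u m1" "lpath m1 v m2" "lpath m2 x m3" "lpath m3 y m4" "lpath m4 z b"
    using assms(1) by (auto simp: lpath_append_iff)
  have "lpath a (u @ v) m2" "lpath a (u @ v @ x) m3" "lpath a (u @ v @ x @ y) m4"
    using m by (auto simp: lpath_append_iff)
  then have "m1 = lpath_end a u" "m2 = lpath_end a (u @ v)" "m3 = lpath_end a (u @ v @ x)"
    "m4 = lpath_end a (u @ v @ x @ y)"
    using m(1) by (simp_all add: lpath_end_eq)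
  then have "m1 = m2" "m3 = m4"
    using assms(2,3) by simp_all
  then show ?thesis
    using m unfolding lpath_append_iff by blast
qed

lemma free_accepts_pump:
  assumes "free_accepts \<Delta> a b (u @ v @ x @ y @ z)"
    and "lpath_end a u = lpath_end a (u @ v)" "lpath_end a (u @ v @ x) = lpath_end a (u @ v @ x @ y)"
    and "word_mat (lpath_gens (u @ v @ x)) = word_mat (lpath_gens (u @ v))"
    and "word_mat (lpath_gens (u @ v @ x @ y)) = word_mat (lpath_gens u)"
  shows "free_accepts \<Delta> a b (u @ v @ v @ x @ y @ y @ z)"
  using assms lpath_pump[of a u v x y z b] word_mat_pump[of "lpath_gens u" "lpath_gens v" "lpath_gens x"]
  by (auto simp: free_accepts_def)

lemma take_eq_take_append_segment:
  assumes "i \<le> j"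
  shows "take j xs = take i xs @ drop i (take j xs)"
  using assms by (simp add: drop_take flip: take_add)

lemma length_lpath_input_segment:
  "j \<le> length xs \<Longrightarrow>
    length (lpath_input (drop i (take j xs))) = (\<Sum>p\<in>{i..<j}. length (opt_list (fst (snd (xs ! p)))))"
proof (induction j)
  case (Suc j)
  show ?case
  proof (cases "i \<le> j")
    case True
    then have "drop i (take (Suc j) xs) = drop i (take j xs) @ [xs ! j]"
      using Suc.prems by (simp add: take_Suc_conv_app_nth)
    then show ?thesis
      using Suc True by (simp add: lpath_input_def)
  qed simp
qed simp

definition run_label :: "'l \<Rightarrow> ('l \<times> 'i \<times> 'l \<times> 'g) list \<Rightarrow> nat \<Rightarrow> 'l" where
  "run_label a xs p = lpath_end a (take p xs)"

definition run_stack :: "('l \<times> 'i \<times> 'l \<times> gen) list \<Rightarrow> nat \<Rightarrow> gen list" where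
  "run_stack xs p = foldl cancel_snoc [] (take p (lpath_gens xs))"

definition run_reads :: "('l \<times> 'a option \<times> 'l \<times> 'g) list \<Rightarrow> nat \<Rightarrow> nat" where
  "run_reads xs p = length (opt_list (fst (snd (xs ! p))))"

lemma word_mat_run_stack: "word_mat (run_stack xs p) = word_mat (lpath_gens (take p xs))"
  by (simp add: run_stack_def word_mat_foldl_cancel_snoc lpath_gens_def take_map)

lemma run_no_reads_in_loops:
  assumes acc: "free_accepts \<Delta> a b xs" and L: "unpumpable L" "\<forall>ys. free_accepts \<Delta> a b ys \<longrightarrow> lpath_input ys \<in> L"
    and ijkl: "i \<le> j" "j \<le> k" "k \<le> l" "l \<le> length xs"
    and lab: "run_label a xs i = run_label a xs j" "run_label a xs k = run_label a xs l"
    and stk: "run_stack xs i = run_stack xs l" "run_stack xs j = run_stack xs k"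
  shows "sum (run_reads xs) {i..<j} + sum (run_reads xs) {k..<l} = 0"
proof -
  define u v x y z where "u = take i xs" "v = drop i (take j xs)" "x = drop j (take k xs)"
    "y = drop k (take l xs)" "z = drop l xs"
  have tj: "take j xs = u @ v" and tk: "take k xs = u @ v @ x" and tl: "take l xs = u @ v @ x @ y"
    using ijkl take_eq_take_append_segment unfolding u_v_x_y_z_def by (metis append.assoc)+
  then have xs: "xs = u @ v @ x @ y @ z"
    unfolding u_v_x_y_z_def by (metis append_take_drop_id append.assoc)
  have "word_mat (lpath_gens (take i xs)) = word_mat (lpath_gens (take l xs))"
    "word_mat (lpath_gens (take j xs)) = word_mat (lpath_gens (take k xs))"
    using stk word_mat_run_stack[of xs] by metis+
  moreover have "free_accepts \<Delta> a b (u @ v @ x @ y @ z)"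
    using acc by (simp only: xs[symmetric])
  ultimately have "free_accepts \<Delta> a b (u @ v @ v @ x @ y @ y @ z)"
    using lab unfolding run_label_def
    by (intro free_accepts_pump) (simp_all only: u_v_x_y_z_def(1)[symmetric] tj tk tl)
  then have "lpath_input u @ lpath_input v @ lpath_input v @ lpath_input x @ lpath_input y @
      lpath_input y @ lpath_input z \<in> L"
    using L(2) by fastforce
  moreover have "lpath_input u @ lpath_input v @ lpath_input x @ lpath_input y @ lpath_input z \<in> L"
    using L(2) acc xs by fastforce
  ultimately have "lpath_input v = []" "lpath_input y = []"
    using L(1) unfolding unpumpable_def by blast+
  then show ?thesis
    using length_lpath_input_segment[of j xs i] length_lpath_input_segment[of l xs k] ijkl
    by (simp add: run_reads_def u_v_x_y_z_def)
qed

lemma run_stack_walk: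
  assumes "finite \<Lambda>" "a \<in> \<Lambda>" "\<forall>x\<in>\<Delta>. fst (snd (snd x)) \<in> \<Lambda>"
    and "free_accepts \<Delta> a b xs" "unpumpable L" "\<forall>ys. free_accepts \<Delta> a b ys \<longrightarrow> lpath_input ys \<in> L"
  shows "stack_walk (length xs) (run_label a xs) (run_stack xs) (run_reads xs) \<Lambda>"
proof
  show "finite \<Lambda>"
    by fact
  show "run_label a xs p \<in> \<Lambda>" for p
  proof -
    have "set (take p xs) \<subseteq> \<Delta>"
      using assms(4) set_take_subset[of p xs] by (auto simp: free_accepts_def)
    then have "insert a ((\<lambda>x. fst (snd (snd x))) ` set (take p xs)) \<subseteq> \<Lambda>"
      using assms(2,3) by blast
    then show ?thesis
      using lpath_end_in_targets[of a "take p xs"] unfolding run_label_def by blast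
  qed
  show "(\<exists>z. run_stack xs (Suc p) = run_stack xs p @ [z]) \<or> (\<exists>z. run_stack xs p = run_stack xs (Suc p) @ [z])"
    if "p < length xs" for p
  proof -
    have "take (Suc p) (lpath_gens xs) = take p (lpath_gens xs) @ [lpath_gens xs ! p]"
      using that by (simp add: take_Suc_conv_app_nth lpath_gens_def)
    then have "run_stack xs (Suc p) = cancel_snoc (run_stack xs p) (lpath_gens xs ! p)"
      by (simp add: run_stack_def)
    then show ?thesis
      using cancel_snoc_push_or_pop by metis
  qed
  show "run_reads xs p \<le> 1" for p
    by (simp add: run_reads_def opt_list_def split: option.split)
  show "sum (run_reads xs) {i..<j} + sum (run_reads xs) {k..<l} = 0"
    if "i \<le> j" "j \<le> k" "k \<le> l" "l \<le> length xs" "run_label a xs i = run_label a xs j"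
      "run_label a xs k = run_label a xs l" "run_stack xs i = run_stack xs l" "run_stack xs j = run_stack xs k"
    for i j k l
    using run_no_reads_in_loops[OF assms(4-6) that] .
qed

theorem free_accepts_input_bound:
  assumes "finite \<Lambda>" "a \<in> \<Lambda>" "\<forall>x\<in>\<Delta>. fst (snd (snd x)) \<in> \<Lambda>"
    and "unpumpable L" "\<forall>ys. free_accepts \<Delta> a b ys \<longrightarrow> lpath_input ys \<in> L"
    and "free_accepts \<Delta> a b xs"
  shows "length (lpath_input xs) \<le> read_bound (card \<Lambda>) (card \<Lambda> * card \<Lambda>)"
proof -
  interpret stack_walk "length xs" "run_label a xs" "run_stack xs" "run_reads xs" \<Lambda>
    using assms(1-3,6,4,5) by (rule run_stack_walk)
  have "reduced (run_stack xs (length xs))"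
    unfolding run_stack_def by (rule reduced_foldl_cancel_snoc) (simp add: reduced_def)
  moreover have "word_mat (run_stack xs (length xs)) = mat 1"
    using assms(6) word_mat_run_stack[of xs] by (simp add: free_accepts_def)
  ultimately have "run_stack xs (length xs) = []"
    by (rule reduced_word_mat_eq_one)
  moreover have "run_stack xs 0 = []"
    by (simp add: run_stack_def)
  moreover have "length (lpath_input xs) = reads 0 (length xs)"
    using length_lpath_input_segment[of "length xs" xs 0] by (simp add: reads_def run_reads_def)
  ultimately show ?thesis
    using reads_bound by simp
qed

section \<open>The language of the words 0^n 1^n 2^n\<close>

definition abc_lang :: "nat list set" where
  "abc_lang = {replicate n 0 @ replicate n 1 @ replicate n 2 | n. True}"

lemma abc_lang_props:
  "w \<in> abc_lang \<Longrightarrow> sorted w \<and> set w \<subseteq> {0, 1, 2} \<and> count_list w 0 = count_list w 1 \<and> count_list w 1 = count_list w 2"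
  unfolding abc_lang_def by (auto simp: count_list_eq_length_filter sorted_append)

lemma card_set_le_1_if_sorted_square: "sorted (v @ v) \<Longrightarrow> card (set v) \<le> 1"
  by (auto simp: card_le_Suc0_iff_eq sorted_append intro: order.antisym)

lemma length_eq_count_list_012:
  "set ws \<subseteq> {0, 1, 2} \<Longrightarrow> length ws = count_list ws 0 + count_list ws 1 + count_list (ws :: nat list) 2"
  by (induction ws) auto

lemma all_letters_if_equal_counts:
  assumes "set ws \<subseteq> {0, 1, 2}" "ws \<noteq> []"
    and "count_list ws 0 = count_list ws 1" "count_list ws 1 = count_list (ws :: nat list) 2"
  shows "{0, 1, 2} \<subseteq> set ws"
proof -
  have "0 < length ws"
    using assms(2) by simp
  then have "0 < count_list ws 0"
    using length_eq_count_list_012[OF assms(1)] assms(3,4) by linarith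
  then have "count_list ws x \<noteq> 0" if "x \<in> {0, 1, 2}" for x
    using assms(3,4) that by auto
  then show ?thesis
    by (auto simp: count_list_0_iff)
qed

lemma unpumpable_abc_lang: "unpumpable abc_lang"
  unfolding unpumpable_def
proof (intro allI impI)
  fix u v x y z :: "nat list"
  assume w1: "u @ v @ x @ y @ z \<in> abc_lang" and w2: "u @ v @ v @ x @ y @ y @ z \<in> abc_lang"
  have "count_list (v @ y) 0 = count_list (v @ y) 1" "count_list (v @ y) 1 = count_list (v @ y) 2"
    using abc_lang_props[OF w1] abc_lang_props[OF w2] by simp_all
  moreover have "set (v @ y) \<subseteq> {0, 1, 2}"
    using abc_lang_props[OF w2] by auto
  moreover have "card (set (v @ y)) \<le> 2"
  proof -
    have "sorted (v @ v)" "sorted (y @ y)"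
      using abc_lang_props[OF w2] by (simp_all add: sorted_append)
    then have "card (set v) \<le> 1" "card (set y) \<le> 1"
      using card_set_le_1_if_sorted_square by blast+
    then show ?thesis
      using card_Un_le[of "set v" "set y"] by simp
  qed
  ultimately have "v @ y = []"
    using all_letters_if_equal_counts[of "v @ y"] card_mono[of "set (v @ y)" "{0, 1, 2 :: nat}"] by fastforce
  then show "v = [] \<and> y = []"
    by simp
qed

theorem abc_lang_not_SL2: "abc_lang \<notin> lang_class (SL_carrier :: (int^2^2) set) (**) (mat 1)"
proof
  assume "abc_lang \<in> lang_class (SL_carrier :: (int^2^2) set) (**) (mat 1)"
  then obtain Q \<Sigma> \<delta> q0 Qa where A: "G_automaton (SL_carrier :: (int^2^2) set) Q \<Sigma> \<delta> q0 Qa"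
    and L: "abc_lang = accepted_lang (**) (mat 1) \<delta> q0 Qa"
    unfolding lang_class_def by blast
  have fin: "finite Q" "finite \<delta>" and "q0 \<in> Q"
    and \<delta>: "\<forall>(q, s, q', m)\<in>\<delta>. q' \<in> Q \<and> det m = 1"
    using A unfolding G_automaton_def SL_carrier_def by fastforce+
  then have dets: "\<forall>(q, s, q', m)\<in>\<delta>. det m = 1"
    by fast
  define K where "K = card (sim_labels Q \<delta>)"
  define n where "n = Suc (read_bound K (K * K))"
  have "replicate n 0 @ replicate n 1 @ replicate n 2 \<in> abc_lang"
    unfolding abc_lang_def by blast
  then obtain qf xs where "qf \<in> Qa" "free_accepts (sim_steps \<delta>) (State q0 (mat 1)) (State qf (mat 1)) xs"
    and input: "lpath_input xs = replicate n 0 @ replicate n 1 @ replicate n 2"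
    using sim_accepts_iff[OF dets] unfolding L accepted_lang_def by blast
  moreover have "\<forall>ys. free_accepts (sim_steps \<delta>) (State q0 (mat 1)) (State qf (mat 1)) ys \<longrightarrow>
      lpath_input ys \<in> abc_lang"
    using sim_accepts_iff[OF dets] \<open>qf \<in> Qa\<close> unfolding L accepted_lang_def by blast
  moreover have "State q0 (mat 1) \<in> sim_labels Q \<delta>"
    using \<open>q0 \<in> Q\<close> coset_rep_in_coset_reps[of "mat 1"] by (auto simp: sim_labels_def)
  ultimately have "length (lpath_input xs) \<le> read_bound K (K * K)"
    unfolding K_def
    using free_accepts_input_bound[OF finite_sim_labels[OF fin] _ _ unpumpable_abc_lang] sim_steps_target[OF _ \<delta>]
    by blast
  then show False
    using input by (simp add: n_def)
qed

section \<open>Embeddings of groups and the main theorem\<close>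

definition map_trans :: "('g \<Rightarrow> 'h) \<Rightarrow> (nat \<times> nat option \<times> nat \<times> 'g) set \<Rightarrow> (nat \<times> nat option \<times> nat \<times> 'h) set" where
  "map_trans h \<delta> = (\<lambda>(q, s, q', m). (q, s, q', h m)) ` \<delta>"

context
  fixes h :: "'g \<Rightarrow> 'h" and mul :: "'g \<Rightarrow> 'g \<Rightarrow> 'g" and e :: 'g and mul' :: "'h \<Rightarrow> 'h \<Rightarrow> 'h" and e' :: 'h
  assumes hom_mul: "\<And>x y. h (mul x y) = mul' (h x) (h y)" and hom_unit: "h e = e'"
begin

lemma reach_map_trans:
  "reach mul e \<delta> q0 q w x \<Longrightarrow> reach mul' e' (map_trans h \<delta>) q0 q w (h x)"
proof (induction rule: reach.induct)
  case start
  then show ?case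
    using reach.start hom_unit by metis
next
  case (read q w x a q' m)
  then have "(q, Some a, q', h m) \<in> map_trans h \<delta>"
    by (force simp: map_trans_def)
  then show ?case
    using reach.read[OF read.IH] hom_mul by metis
next
  case (eps q w x q' m)
  then have "(q, None, q', h m) \<in> map_trans h \<delta>"
    by (force simp: map_trans_def)
  then show ?case
    using reach.eps[OF eps.IH] hom_mul by metis
qed

lemma reach_map_trans_inv:
  "reach mul' e' (map_trans h \<delta>) q0 q w y \<Longrightarrow> \<exists>x. reach mul e \<delta> q0 q w x \<and> y = h x"
proof (induction rule: reach.induct)
  case start
  then show ?case
    using reach.start hom_unit by metis
next
  case (read q w y a q' m')
  then obtain x m where "reach mul e \<delta> q0 q w x" "y = h x" "(q, Some a, q', m) \<in> \<delta>" "m' = h m"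
    by (auto simp: map_trans_def)
  then show ?case
    using reach.read hom_mul by metis
next
  case (eps q w y q' m')
  then obtain x m where "reach mul e \<delta> q0 q w x" "y = h x" "(q, None, q', m) \<in> \<delta>" "m' = h m"
    by (auto simp: map_trans_def)
  then show ?case
    using reach.eps hom_mul by metis
qed

lemma lang_class_mono_hom:
  assumes "h ` Gc \<subseteq> Gc'" "inj h"
  shows "lang_class Gc mul e \<subseteq> lang_class Gc' mul' e'"
proof
  fix L
  assume "L \<in> lang_class Gc mul e"
  then obtain Q \<Sigma> \<delta> q0 Qa where A: "G_automaton Gc Q \<Sigma> \<delta> q0 Qa"
    and L: "L = accepted_lang mul e \<delta> q0 Qa"
    unfolding lang_class_def by blast
  have "G_automaton Gc' Q \<Sigma> (map_trans h \<delta>) q0 Qa"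
    using A assms(1) unfolding G_automaton_def map_trans_def by fastforce
  moreover have "reach mul' e' (map_trans h \<delta>) q0 q w e' \<longleftrightarrow> reach mul e \<delta> q0 q w e" for q w
    using reach_map_trans reach_map_trans_inv hom_unit injD[OF assms(2)] by metis
  then have "L = accepted_lang mul' e' (map_trans h \<delta>) q0 Qa"
    unfolding L accepted_lang_def by simp
  ultimately show "L \<in> lang_class Gc' mul' e'"
    unfolding lang_class_def by blast
qed

end


definition mat3 :: "'a \<Rightarrow> 'a \<Rightarrow> 'a \<Rightarrow> 'a \<Rightarrow> 'a \<Rightarrow> 'a \<Rightarrow> 'a \<Rightarrow> 'a \<Rightarrow> 'a \<Rightarrow> 'a^3^3" where
  "mat3 a b c d e f g h k = (\<chi> i j. if i = 1 then (if j = 1 then a else if j = 2 then b else c)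
      else if i = 2 then (if j = 1 then d else if j = 2 then e else f)
      else (if j = 1 then g else if j = 2 then h else k))"

lemma mat3_eq_iff:
  "mat3 a b c d e f g h k = mat3 a' b' c' d' e' f' g' h' k' \<longleftrightarrow>
    a = a' \<and> b = b' \<and> c = c' \<and> d = d' \<and> e = e' \<and> f = f' \<and> g = g' \<and> h = h' \<and> k = k'"
  unfolding vec_eq_iff forall_3 by (simp add: mat3_def)

lemma mat3_mult:
  fixes a b c d e f g h k :: "'a::semiring_1"
  shows "mat3 a b c d e f g h k ** mat3 a' b' c' d' e' f' g' h' k' =
    mat3 (a*a' + b*d' + c*g') (a*b' + b*e' + c*h') (a*c' + b*f' + c*k')
         (d*a' + e*d' + f*g') (d*b' + e*e' + f*h') (d*c' + e*f' + f*k')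
         (g*a' + h*d' + k*g') (g*b' + h*e' + k*h') (g*c' + h*f' + k*k')"
  unfolding vec_eq_iff forall_3 by (simp add: mat3_def matrix_matrix_mult_def sum_3)

lemma mat3_one: "(mat 1 :: 'a::zero_neq_one^3^3) = mat3 1 0 0 0 1 0 0 0 1"
  unfolding vec_eq_iff forall_3 by (simp add: mat3_def mat_def)

lemma det_mat3: "det (mat3 a b c d e f g h k) = a*e*k + b*f*g + c*d*h - a*f*h - b*d*k - c*e*g"
  by (simp add: det_3 mat3_def)

definition embed3 :: "'a::zero_neq_one^2^2 \<Rightarrow> 'a^3^3" where
  "embed3 M = mat3 (M$1$1) (M$1$2) 0 (M$2$1) (M$2$2) 0 0 0 1"

lemma embed3_mult: "embed3 (A ** B) = embed3 A ** embed3 (B :: 'a::semiring_1^2^2)"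
  by (cases A rule: mat2_cases, cases B rule: mat2_cases) (simp add: embed3_def mat3_mult)

lemma embed3_one: "embed3 (mat 1) = mat 1"
  by (simp add: embed3_def mat2_one mat3_one)

lemma inj_embed3: "inj embed3"
  by (rule injI, subst mat2_eta, subst (2) mat2_eta) (simp add: embed3_def mat3_eq_iff)

lemma det_embed3: "det (embed3 A) = det (A :: 'a::comm_ring_1^2^2)"
  by (simp add: embed3_def det_mat3 det_2)

lemma lang_SL2_subset_SL3:
  "lang_class (SL_carrier :: (int^2^2) set) (**) (mat 1) \<subseteq> lang_class (SL_carrier :: (int^3^3) set) (**) (mat 1)"
  by (rule lang_class_mono_hom[of embed3]) (auto simp: embed3_mult embed3_one inj_embed3 det_embed3 SL_carrier_def)

text \<open>The shears form a copy of Z^2; the automaton below keeps the number of 0s minus the number of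
  1s in one coordinate and the number of 1s minus the number of 2s in the other.\<close>

definition shear :: "int \<Rightarrow> int \<Rightarrow> int^3^3" where
  "shear u v = mat3 1 u v 0 1 0 0 0 1"

lemma shear_mult [simp]: "shear u v ** shear u' v' = shear (u + u') (v + v')"
  by (simp add: shear_def mat3_mult algebra_simps)

lemma shear_zero: "shear 0 0 = mat 1"
  by (simp add: shear_def mat3_one)

lemma shear_eq_one_iff: "shear u v = mat 1 \<longleftrightarrow> u = 0 \<and> v = 0"
  by (simp add: shear_def mat3_one mat3_eq_iff)

lemma det_shear: "det (shear u v) = 1"
  by (simp add: shear_def det_mat3)

definition abc_trans :: "(nat \<times> nat option \<times> nat \<times> (int^3^3)) set" where
  "abc_trans = {(0, Some 0, 0, shear 1 0), (0, None, 1, shear 0 0), (1, Some 1, 1, shear (-1) 1),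
                (1, None, 2, shear 0 0), (2, Some 2, 2, shear 0 (-1))}"

lemma reach_abc_trans:
  "reach (**) (mat 1) abc_trans 0 q w y \<Longrightarrow>
    \<exists>i j k. w = replicate i 0 @ replicate j 1 @ replicate k 2 \<and> y = shear (int i - int j) (int j - int k) \<and>
      (q = 0 \<and> j = 0 \<and> k = 0 \<or> q = 1 \<and> k = 0 \<or> q = 2)"
proof (induction rule: reach.induct)
  case start
  show ?case
    by (intro exI[of _ 0]) (simp add: shear_zero)
next
  case (read q w y a q' m)
  then obtain i j k where w: "w = replicate i 0 @ replicate j 1 @ replicate k 2"
    and y: "y = shear (int i - int j) (int j - int k)" and q: "q = 0 \<and> j = 0 \<and> k = 0 \<or> q = 1 \<and> k = 0 \<or> q = 2"
    by blast
  from read.hyps(2) consider "q = 0" "a = 0" "q' = 0" "m = shear 1 0" | "q = 1" "a = 1" "q' = 1" "m = shear (-1) 1"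
    | "q = 2" "a = 2" "q' = 2" "m = shear 0 (-1)"
    by (auto simp: abc_trans_def)
  then show ?case
  proof cases
    case 1
    then show ?thesis
      using w y q by (intro exI[of _ "Suc i"] exI[of _ 0] exI[of _ 0]) (auto simp: replicate_append_same algebra_simps)
  next
    case 2
    then show ?thesis
      using w y q by (intro exI[of _ i] exI[of _ "Suc j"] exI[of _ 0]) (auto simp: replicate_append_same algebra_simps)
  next
    case 3
    then show ?thesis
      using w y q by (intro exI[of _ i] exI[of _ j] exI[of _ "Suc k"]) (auto simp: replicate_append_same algebra_simps)
  qed
next
  case (eps q w y q' m)
  then show ?case
    by (fastforce simp: abc_trans_def)
qed

lemma reach_shear_loop:
  assumes "reach (**) (mat 1) \<delta> q0 q w (shear u v)" "(q, Some a, q, shear du dv) \<in> \<delta>"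
  shows "reach (**) (mat 1) \<delta> q0 q (w @ replicate n a) (shear (u + int n * du) (v + int n * dv))"
proof (induction n)
  case 0
  then show ?case
    using assms(1) by simp
next
  case (Suc n)
  from reach.read[OF this assms(2)] show ?case
    by (simp add: replicate_append_same algebra_simps flip: replicate_Suc)
qed

lemma abc_lang_SL3: "abc_lang \<in> lang_class (SL_carrier :: (int^3^3) set) (**) (mat 1)"
proof -
  have A: "G_automaton (SL_carrier :: (int^3^3) set) {0, 1, 2} {0, 1, 2} abc_trans 0 {2}"
    unfolding G_automaton_def SL_carrier_def abc_trans_def by (auto simp: det_shear)
  have runs: "reach (**) (mat 1) abc_trans 0 2 (replicate i 0 @ replicate j 1 @ replicate k 2)
      (shear (int i - int j) (int j - int k))" for i j k
  proof -
    have "(0, Some 0, 0, shear 1 0) \<in> abc_trans" "(0, None, 1, shear 0 0) \<in> abc_trans"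
      "(1, Some 1, 1, shear (-1) 1) \<in> abc_trans" "(1, None, 2, shear 0 0) \<in> abc_trans"
      "(2, Some 2, 2, shear 0 (-1)) \<in> abc_trans"
      by (simp_all add: abc_trans_def)
    note loop = reach_shear_loop[OF _ this(1)] reach_shear_loop[OF _ this(3)] reach_shear_loop[OF _ this(5)]
      and eps = reach.eps[OF _ this(2)] reach.eps[OF _ this(4)]
    have "reach (**) (mat 1) abc_trans 0 0 ([] @ replicate i 0) (shear (0 + int i * 1) (0 + int i * 0))"
      using reach.start shear_zero by (metis loop(1))
    from eps(1)[OF this] have "reach (**) (mat 1) abc_trans 0 1 (replicate i 0) (shear (int i) 0)"
      by (simp add: shear_zero)
    from eps(2)[OF loop(2)[OF this, of j]]
    have "reach (**) (mat 1) abc_trans 0 2 (replicate i 0 @ replicate j 1) (shear (int i - int j) (int j))"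
      by (simp add: shear_zero)
    from loop(3)[OF this, of k] show ?thesis
      by simp
  qed
  have "reach (**) (mat 1) abc_trans 0 2 w (mat 1) \<longleftrightarrow> w \<in> abc_lang" for w
  proof -
    have "reach (**) (mat 1) abc_trans 0 2 w (mat 1) \<Longrightarrow> \<exists>i. w = replicate i 0 @ replicate i 1 @ replicate i 2"
      by (drule reach_abc_trans) (auto simp: shear_eq_one_iff dest!: sym[of "mat 1"])
    then show ?thesis
      unfolding abc_lang_def using runs[of n n n for n] by (auto simp: shear_zero)
  qed
  then have "abc_lang = accepted_lang (**) (mat 1) abc_trans 0 {2}"
    by (simp add: accepted_lang_def)
  then show ?thesis
    unfolding lang_class_def using A by blast
qed

theorem theorem3p8:
  shows "lang_class (SL_carrier :: (int^2^2) set) (**) (mat 1)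
         \<subset> lang_class (SL_carrier :: (int^3^3) set) (**) (mat 1)"
  using lang_SL2_subset_SL3 abc_lang_SL3 abc_lang_not_SL2 by blast

end
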